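(* Let $\mathbb{D}=\{(x^1,x^2)\in\mathbb{R}^2:(x^1)^2+(x^2)^2<1\}$, let $0<b<1$, and let $(\mathbb{D},F=\alpha+\beta)$ be the Randers Poincaré disc with $$\alpha=\frac{2\sqrt{(dx^1)^2+(dx^2)^2}}{1-(x^1)^2-(x^2)^2},\qquad \beta=b\,\frac{x^1dx^1+x^2dx^2}{(1-(x^1)^2-(x^2)^2)\sqrt{(x^1)^2+(x^2)^2}}.$$ Then the space $(\mathbb{D},F)$ does not have constant negative flag curvature.
   Context: For a Finsler metric $F=F(x,y)$, smooth for $y\neq0$, put $g_{ij}=\frac12\frac{\partial^2F^2}{\partial y^i\partial y^j}$, $(g^{ij})=(g_{ij})^{-1}$, $G^i=\frac14g^{il}\left(\frac{\partial^2F^2}{\partial x^k\partial y^l}y^k-\frac{\partial F^2}{\partial x^l}\right)$ and $$R^i_k=2\frac{\partial G^i}{\partial x^k}-y^j\frac{\partial^2G^i}{\partial x^j\partial y^k}+2G^j\frac{\partial^2G^i}{\partial y^j\partial y^k}-\frac{\partial G^i}{\partial y^j}\frac{\partial G^j}{\partial y^k}.$$ $F$ has constant flag curvature $K\in\mathbb{R}$ if $R^i_k=K\left(F^2\delta^i_k-F\frac{\partial F}{\partial y^k}y^i\right)$ for all $x$ and all $y\neq0$; it has constant negative flag curvature if this holds for some $K<0$. *)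

theory Defs
  imports "HOL-Analysis.Analysis"
begin

text \<open>Functions of a point and a tangent vector of an open subset of \<open>real ^ 'n\<close>, in the
  standard coordinates \<open>(x, y)\<close>.\<close>

type_synonym 'n tangent_fun = "real ^ 'n \<Rightarrow> real ^ 'n \<Rightarrow> real"

definition pdx :: "'n::finite \<Rightarrow> 'n tangent_fun \<Rightarrow> 'n tangent_fun" where
  "pdx i f x y = deriv (\<lambda>t. f (x + t *\<^sub>R axis i 1) y) 0"

definition pdy :: "'n::finite \<Rightarrow> 'n tangent_fun \<Rightarrow> 'n tangent_fun" where
  "pdy i f x y = deriv (\<lambda>t. f x (y + t *\<^sub>R axis i 1)) 0"

definition fsq :: "'n::finite tangent_fun \<Rightarrow> 'n tangent_fun" where
  "fsq F x y = (F x y)\<^sup>2"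

definition fundamental_tensor ::
  "'n::finite tangent_fun \<Rightarrow> real ^ 'n \<Rightarrow> real ^ 'n \<Rightarrow> real ^ 'n ^ 'n" where
  "fundamental_tensor F x y = (\<chi> i j. 1/2 * pdy i (pdy j (fsq F)) x y)"

definition spray_coeff :: "'n::finite tangent_fun \<Rightarrow> 'n \<Rightarrow> 'n tangent_fun" where
  "spray_coeff F i x y =
     1/4 * (\<Sum>l\<in>UNIV. matrix_inv (fundamental_tensor F x y) $ i $ l *
       ((\<Sum>k\<in>UNIV. pdx k (pdy l (fsq F)) x y * y $ k) - pdx l (fsq F) x y))"

definition riemann_curvature :: "'n::finite tangent_fun \<Rightarrow> 'n \<Rightarrow> 'n \<Rightarrow> 'n tangent_fun" where
  "riemann_curvature F i k x y =
     2 * pdx k (spray_coeff F i) x y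
     - (\<Sum>j\<in>UNIV. y $ j * pdx j (pdy k (spray_coeff F i)) x y)
     + 2 * (\<Sum>j\<in>UNIV. spray_coeff F j x y * pdy j (pdy k (spray_coeff F i)) x y)
     - (\<Sum>j\<in>UNIV. pdy j (spray_coeff F i) x y * pdy k (spray_coeff F j) x y)"

text \<open>\<open>M\<close> is meant to be an open set on which \<open>F\<close> is a Finsler metric; the values of \<open>F\<close>
  at points outside \<open>M\<close> are irrelevant.\<close>

definition has_constant_flag_curvature ::
  "(real ^ 'n) set \<Rightarrow> 'n::finite tangent_fun \<Rightarrow> real \<Rightarrow> bool" where
  "has_constant_flag_curvature M F K \<longleftrightarrow>
     (\<forall>x\<in>M. \<forall>y. y \<noteq> 0 \<longrightarrow> (\<forall>i k.
        riemann_curvature F i k x y =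
          K * ((F x y)\<^sup>2 * (if i = k then 1 else 0) - F x y * pdy k F x y * y $ i)))"

definition has_constant_negative_flag_curvature ::
  "(real ^ 'n) set \<Rightarrow> 'n::finite tangent_fun \<Rightarrow> bool" where
  "has_constant_negative_flag_curvature M F \<longleftrightarrow>
     (\<exists>K<0. has_constant_flag_curvature M F K)"

lemma has_constant_negative_flag_curvature_subset:
  assumes "has_constant_negative_flag_curvature M F" "N \<subseteq> M"
  shows "has_constant_negative_flag_curvature N F"
  using assms
  unfolding has_constant_negative_flag_curvature_def has_constant_flag_curvature_def by blast

definition unit_disc :: "(real ^ 2) set" where
  "unit_disc = {x. (x $ 1)\<^sup>2 + (x $ 2)\<^sup>2 < 1}"

definition poincare_alpha :: "2 tangent_fun" where
  "poincare_alpha x y =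
     2 * sqrt ((y $ 1)\<^sup>2 + (y $ 2)\<^sup>2) / (1 - (x $ 1)\<^sup>2 - (x $ 2)\<^sup>2)"

text \<open>The one-form \<open>\<beta>\<close> has no continuous extension to the origin; the value \<open>0\<close> that division
  by zero gives there has no meaning. The Randers metric below is therefore a Finsler metric only
  on \<open>unit_disc - {0}\<close>, and curvature conditions should be imposed there. By
  \<open>has_constant_negative_flag_curvature_subset\<close>, refuting constant negative flag curvature on
  \<open>unit_disc - {0}\<close> also refutes it on \<open>unit_disc\<close>.\<close>

definition poincare_beta :: "real \<Rightarrow> 2 tangent_fun" where
  "poincare_beta b x y =
     b * ((x $ 1 * y $ 1 + x $ 2 * y $ 2) /
          ((1 - (x $ 1)\<^sup>2 - (x $ 2)\<^sup>2) * sqrt ((x $ 1)\<^sup>2 + (x $ 2)\<^sup>2)))"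

definition randers_poincare :: "real \<Rightarrow> 2 tangent_fun" where
  "randers_poincare b x y = poincare_alpha x y + poincare_beta b x y"

end

theory Submission imports Defs begin

text \<open>Constant flag curvature \<open>K\<close> already fails on radial flags. The form \<open>\<beta>\<close> is closed and, away
  from the origin, equals half of \<open>b\<close> times the differential of the hyperbolic distance to the
  origin. Hence the spray of \<open>F\<close> is that of \<open>\<alpha>\<close> plus \<open>P y\<close>, where \<open>P\<close> vanishes to second order
  in radial directions. On a radial flag the curvature of \<open>F\<close> is therefore that of \<open>\<alpha>\<close>, namely
  \<open>R = -\<alpha>\<^sup>2\<close>, so \<open>K F\<^sup>2 = -\<alpha>\<^sup>2\<close> both for the outward and for the inward radial vector. But
  \<open>F = (1 \<plusminus> b/2) \<alpha>\<close> there.\<close>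

section \<open>Partial derivatives\<close>

text \<open>\<open>deriv\<close> at 0 depends only on the germ, so \<open>f\<close> may be traded
  for a closed form \<open>g\<close> known merely on an open set. This is what iterated partials
  need: the inner derivative has a formula only off the zero vector or in the punctured
  disc.\<close>

lemma line_deriv_eqI:
  fixes v :: "'a::real_normed_vector"
  assumes "open S" "x \<in> S"
    and eq: "\<And>x'. x' \<in> S \<Longrightarrow> f x' = g x'"
    and D: "((\<lambda>t. g (x + t *\<^sub>R v)) has_real_derivative D) (at 0)"
  shows "deriv (\<lambda>t. f (x + t *\<^sub>R v)) 0 = D"
proof -
  have "((\<lambda>t. x + t *\<^sub>R v) \<longlongrightarrow> x + 0 *\<^sub>R v) (nhds 0)"
    by (intro tendsto_intros filterlim_ident)
  from topological_tendstoD[OF this assms(1)] assms(2)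
  have ev: "\<forall>\<^sub>F t in nhds 0. x + t *\<^sub>R v \<in> S"
    by simp
  have "\<forall>\<^sub>F t in nhds 0. f (x + t *\<^sub>R v) = g (x + t *\<^sub>R v)"
    using ev by eventually_elim (rule eq)
  from DERIV_cong_ev[OF refl this refl] D show ?thesis
    by (intro DERIV_imp_deriv) (rule iffD2)
qed

lemma pdx_eqI:
  assumes "open S" "x \<in> S" "\<And>x'. x' \<in> S \<Longrightarrow> f x' y = g x'"
    and "((\<lambda>t. g (x + t *\<^sub>R axis i 1)) has_real_derivative D) (at 0)"
  shows "pdx i f x y = D"
  unfolding pdx_def by (rule line_deriv_eqI[where f = "\<lambda>x. f x y", OF assms])

lemma pdy_eqI:
  assumes "open S" "y \<in> S" "\<And>y'. y' \<in> S \<Longrightarrow> f x y' = g y'"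
    and "((\<lambda>t. g (y + t *\<^sub>R axis i 1)) has_real_derivative D) (at 0)"
  shows "pdy i f x y = D"
  unfolding pdy_def by (rule line_deriv_eqI[where f = "f x", OF assms])

lemma norm_line_has_derivative:
  fixes y v :: "'a::real_inner"
  assumes "y \<noteq> 0"
  shows "((\<lambda>t. norm (y + t *\<^sub>R v)) has_real_derivative (y \<bullet> v) / norm y) (at 0)"
proof -
  have "((\<lambda>t. y + t *\<^sub>R v) has_derivative (\<lambda>t. t *\<^sub>R v)) (at 0)"
    by (rule has_derivative_eq_rhs, (rule derivative_intros)+) simp
  moreover have "(norm has_derivative (\<lambda>h. h \<bullet> sgn y)) (at (y + 0 *\<^sub>R v))"
    using has_derivative_norm[OF assms] by simp
  ultimately have "((\<lambda>t. norm (y + t *\<^sub>R v)) has_derivative (\<lambda>t. (t *\<^sub>R v) \<bullet> sgn y)) (at 0)"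
    by (rule has_derivative_compose)
  then show ?thesis
    unfolding has_field_derivative_def
    by (rule has_derivative_eq_rhs)
       (simp add: fun_eq_iff sgn_div_norm inner_commute divide_inverse mult_ac)
qed

text \<open>Along coordinate lines both \<open>y$j / norm y\<close> and
  \<open>(x \<bullet> y) / norm x\<close> have this shape, so one quotient rule serves \<alpha> and
  \<beta>.\<close>

lemma linear_over_norm_has_derivative:
  fixes x v :: "'a::real_inner"
  assumes "x \<noteq> 0"
  shows "((\<lambda>t. (p + t * q) / norm (x + t *\<^sub>R v)) has_real_derivative
    q / norm x - p * (x \<bullet> v) / norm x ^ 3) (at 0)"
proof -
  have "((\<lambda>t. p + t * q) has_real_derivative q) (at 0)"
    by (auto intro!: derivative_eq_intros)
  from DERIV_divide[OF this norm_line_has_derivative[OF assms]] show ?thesis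
    using assms by (simp add: field_simps power3_eq_cube)
qed

section \<open>The fundamental tensor and the spray\<close>

lemma randers_poincare_eq:
  "randers_poincare b x y = (2 * norm y + b * (x \<bullet> y) / norm x) / (1 - (norm x)\<^sup>2)"
proof -
  have n: "norm z = sqrt ((z$1)\<^sup>2 + (z$2)\<^sup>2)" for z :: "real^2"
    by (simp add: norm_vec_def L2_set_def sum_2)
  have "1 - (norm x)\<^sup>2 = 1 - (x$1)\<^sup>2 - (x$2)\<^sup>2"
    by (simp add: n)
  then show ?thesis
    unfolding randers_poincare_def poincare_alpha_def poincare_beta_def
    by (simp only: n[symmetric]) (simp add: inner_vec_def sum_2 add_divide_distrib
        distrib_left mult.commute)
qed

lemma punctured_disc_iff: "x \<in> unit_disc - {0} \<longleftrightarrow> x \<noteq> 0 \<and> norm x < 1"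
  by (auto simp: unit_disc_def norm_vec_def L2_set_def sum_2 real_sqrt_lt_1_iff)

lemma open_punctured_disc: "open (unit_disc - {0})"
proof -
  have "unit_disc - {0} = ball 0 1 - {0 :: real^2}"
    by (rule set_eqI) (simp only: punctured_disc_iff, simp add: conj_commute)
  then show ?thesis by (simp add: open_delete)
qed

lemma square_norm_lt_1: "x \<in> unit_disc - {0} \<Longrightarrow> 1 - (norm x)\<^sup>2 > 0"
  unfolding punctured_disc_iff by (simp add: abs_square_less_1)

section \<open>First and second derivatives of \<open>F\<close> and of its square\<close>

definition randers_dy :: "real \<Rightarrow> 2 \<Rightarrow> 2 tangent_fun" where
  "randers_dy b i x y = (2 * y$i / norm y + b * x$i / norm x) / (1 - (norm x)\<^sup>2)"

lemma randers_has_dy: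
  assumes "y \<noteq> 0"
  shows "((\<lambda>t. randers_poincare b x (y + t *\<^sub>R axis i 1)) has_real_derivative
    randers_dy b i x y) (at 0)"
proof -
  have "((\<lambda>t. x \<bullet> y + t * x$i) has_real_derivative x$i) (at 0)"
    by (auto intro!: derivative_eq_intros)
  then have "((\<lambda>t. (2 * norm (y + t *\<^sub>R axis i 1) + b * (x \<bullet> y + t * x$i) / norm x) /
      (1 - (norm x)\<^sup>2)) has_real_derivative
    (2 * ((y \<bullet> axis i 1) / norm y) + b * x$i / norm x) / (1 - (norm x)\<^sup>2)) (at 0)"
    by (intro DERIV_cdivide DERIV_add DERIV_cmult norm_line_has_derivative assms)
  then show ?thesis
    by (simp add: randers_poincare_eq randers_dy_def inner_add inner_axis distrib_left)
qed

lemma randers_dy_has_dy: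
  assumes "y \<noteq> 0"
  shows "((\<lambda>t. randers_dy b j x (y + t *\<^sub>R axis i 1)) has_real_derivative
    2 * (axis i 1 $ j / norm y - y$i * y$j / norm y ^ 3) / (1 - (norm x)\<^sup>2)) (at 0)"
proof -
  have "((\<lambda>t. (2 * ((y$j + t * axis i 1 $ j) / norm (y + t *\<^sub>R axis i 1)) + b * x$j / norm x) /
      (1 - (norm x)\<^sup>2)) has_real_derivative
    (2 * (axis i 1 $ j / norm y - y$j * (y \<bullet> axis i 1) / norm y ^ 3) + 0) / (1 - (norm x)\<^sup>2)) (at 0)"
    by (intro DERIV_cdivide DERIV_add DERIV_cmult DERIV_const linear_over_norm_has_derivative assms)
  then show ?thesis
    by (simp add: randers_dy_def inner_axis mult.commute)
qed

text \<open>The summand with \<open>2 * x$k\<close> comes from the conformal factor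
  \<open>1 / (1 - |x|^2)\<close>, whose differentiation reproduces \<open>F\<close> itself.\<close>

definition randers_dx :: "real \<Rightarrow> 2 \<Rightarrow> 2 tangent_fun" where
  "randers_dx b k x y = (b * (y$k / norm x - (x \<bullet> y) * x$k / norm x ^ 3)
    + 2 * x$k * randers_poincare b x y) / (1 - (norm x)\<^sup>2)"

text \<open>Common pattern of \<open>F\<close> (with \<open>p = x \<bullet> y\<close>,
  \<open>q = y$k\<close>) and of its y-partials (with \<open>p = x$l\<close> and \<open>q\<close> a
  Kronecker delta) as functions of \<open>x\<close>.\<close>

lemma over_disc_factor_has_derivative:
  assumes "x \<in> unit_disc - {0}"
  shows "((\<lambda>t. (a + b * ((p + t * q) / norm (x + t *\<^sub>R axis k 1)))
      / (1 - (norm (x + t *\<^sub>R axis k 1))\<^sup>2)) has_real_derivative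
    (b * (q / norm x - p * x$k / norm x ^ 3)
      + 2 * x$k * ((a + b * (p / norm x)) / (1 - (norm x)\<^sup>2))) / (1 - (norm x)\<^sup>2)) (at 0)"
proof -
  have x: "x \<noteq> 0" and m: "1 - (norm x)\<^sup>2 \<noteq> 0"
    using assms square_norm_lt_1[OF assms] by auto
  have num: "((\<lambda>t. a + b * ((p + t * q) / norm (x + t *\<^sub>R axis k 1))) has_real_derivative
      b * (q / norm x - p * x$k / norm x ^ 3)) (at 0)"
    by (rule DERIV_cong[OF DERIV_add[OF DERIV_const
          DERIV_cmult[OF linear_over_norm_has_derivative[OF x]]]]) (simp add: inner_axis)
  have den: "((\<lambda>t. 1 - (norm (x + t *\<^sub>R axis k 1))\<^sup>2) has_real_derivative - (2 * x$k)) (at 0)"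
    by (rule DERIV_cong[OF DERIV_diff[OF DERIV_const
          DERIV_power[OF norm_line_has_derivative[OF x]]]]) (use x in \<open>simp add: inner_axis\<close>)
  \<comment> \<open>Regroups the output of the quotient rule so that the original quotient
    \<open>A / m\<close> reappears.\<close>
  have quot: "(C * m - A * - (2 * X)) / (m * m) = (C + 2 * X * (A / m)) / m"
    if "m \<noteq> 0" for A C X m :: real
    using that by (simp add: field_simps)
  show ?thesis
    using m by (intro DERIV_cong[OF DERIV_divide[OF num den]]) (use quot[OF m] in simp_all)
qed

lemma randers_has_dx:
  assumes "x \<in> unit_disc - {0}"
  shows "((\<lambda>t. randers_poincare b (x + t *\<^sub>R axis k 1) y) has_real_derivative
    randers_dx b k x y) (at 0)"
  using over_disc_factor_has_derivative[OF assms, of "2 * norm y" b "x \<bullet> y" "y$k" k]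
  unfolding randers_poincare_eq randers_dx_def by (simp add: inner_add inner_axis')

lemma randers_dy_has_dx:
  assumes "x \<in> unit_disc - {0}"
  shows "((\<lambda>t. randers_dy b l (x + t *\<^sub>R axis k 1) y) has_real_derivative
    (b * (axis k 1 $ l / norm x - x$k * x$l / norm x ^ 3)
      + 2 * x$k * randers_dy b l x y) / (1 - (norm x)\<^sup>2)) (at 0)"
  using over_disc_factor_has_derivative[OF assms, of "2 * y$l / norm y" b "x$l" "axis k 1 $ l" k]
  unfolding randers_dy_def by (simp add: mult.commute)

lemma pdy_fsq_randers:
  assumes "y \<noteq> 0"
  shows "pdy i (fsq (randers_poincare b)) x y = 2 * randers_poincare b x y * randers_dy b i x y"
proof (rule pdy_eqI[where S = UNIV])
  show "((\<lambda>t. (randers_poincare b x (y + t *\<^sub>R axis i 1))\<^sup>2) has_real_derivative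
      2 * randers_poincare b x y * randers_dy b i x y) (at 0)"
    by (rule DERIV_cong[OF DERIV_power[OF randers_has_dy[OF assms]]]) simp
qed (auto simp: fsq_def)

lemma pdx_fsq_randers:
  assumes "x \<in> unit_disc - {0}"
  shows "pdx i (fsq (randers_poincare b)) x y = 2 * randers_poincare b x y * randers_dx b i x y"
proof (rule pdx_eqI[where S = UNIV])
  show "((\<lambda>t. (randers_poincare b (x + t *\<^sub>R axis i 1) y)\<^sup>2) has_real_derivative
      2 * randers_poincare b x y * randers_dx b i x y) (at 0)"
    by (rule DERIV_cong[OF DERIV_power[OF randers_has_dx[OF assms]]]) simp
qed (auto simp: fsq_def)

text \<open>This is g_ij = F_i F_j + F F_ij with indices for y-partials; \<beta> is linear in y, so
  only \<alpha> enters the Hessian F_ij.\<close>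

lemma fundamental_tensor_randers:
  assumes "y \<noteq> 0"
  shows "fundamental_tensor (randers_poincare b) x y $ i $ j =
    randers_dy b i x y * randers_dy b j x y + randers_poincare b x y *
      (2 * (axis i 1 $ j / norm y - y$i * y$j / norm y ^ 3) / (1 - (norm x)\<^sup>2))"
    (is "_ = ?g")
proof -
  have "pdy i (pdy j (fsq (randers_poincare b))) x y = 2 * ?g"
  proof (rule pdy_eqI[where S = "-{0}"])
    show "((\<lambda>t. 2 * randers_poincare b x (y + t *\<^sub>R axis i 1) *
        randers_dy b j x (y + t *\<^sub>R axis i 1)) has_real_derivative 2 * ?g) (at 0)"
      by (rule DERIV_cong[OF DERIV_mult[OF DERIV_cmult[OF randers_has_dy] randers_dy_has_dy]])
         (simp_all add: assms algebra_simps)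
  qed (use assms in \<open>auto simp: pdy_fsq_randers\<close>)
  then show ?thesis
    by (simp add: fundamental_tensor_def)
qed

lemma pdx_pdy_fsq_randers:
  assumes "x \<in> unit_disc - {0}" "y \<noteq> 0"
  shows "pdx k (pdy l (fsq (randers_poincare b))) x y =
    2 * (randers_dx b k x y * randers_dy b l x y + randers_poincare b x y *
      ((b * (axis k 1 $ l / norm x - x$k * x$l / norm x ^ 3)
        + 2 * x$k * randers_dy b l x y) / (1 - (norm x)\<^sup>2)))" (is "_ = ?h")
proof (rule pdx_eqI[where S = UNIV])
  show "((\<lambda>t. 2 * randers_poincare b (x + t *\<^sub>R axis k 1) y *
      randers_dy b l (x + t *\<^sub>R axis k 1) y) has_real_derivative ?h) (at 0)"
    by (rule DERIV_cong[OF DERIV_mult[OF DERIV_cmult[OF randers_has_dx[OF assms(1)]]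
          randers_dy_has_dx[OF assms(1)]]])
       (simp_all add: algebra_simps)
qed (use assms in \<open>auto simp: pdy_fsq_randers\<close>)

text \<open>Cauchy-Schwarz gives |\<beta>| \<le> (|b|/2) \<alpha>, whence the bound 2.\<close>

lemma randers_poincare_pos:
  assumes "x \<in> unit_disc - {0}" "y \<noteq> 0" "\<bar>b\<bar> < 2"
  shows "randers_poincare b x y > 0"
proof -
  have x: "norm x > 0" using assms by simp
  have "\<bar>b * (x \<bullet> y)\<bar> \<le> \<bar>b\<bar> * (norm x * norm y)"
    unfolding abs_mult by (intro mult_left_mono Cauchy_Schwarz_ineq2) auto
  also have "\<dots> < 2 * (norm x * norm y)"
    using assms x by (intro mult_strict_right_mono) auto
  finally have "2 * norm y + b * (x \<bullet> y) / norm x > 0"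
    using x by (simp add: field_simps abs_if split: if_splits)
  then show ?thesis
    using square_norm_lt_1[OF assms(1)] by (simp add: randers_poincare_eq)
qed

section \<open>Euler's identity and the determinant of the fundamental tensor\<close>

lemma axis_2_nth:
  "axis 1 c $ (1::2) = c" "axis 1 c $ (2::2) = 0" "axis 2 c $ (1::2) = 0" "axis 2 c $ (2::2) = c"
  by (simp_all add: axis_def)

lemma sum_vec_mult_axis: "(\<Sum>k\<in>UNIV. (axis k 1 $ l) * y$k) = (y :: real^'n)$l"
  by (simp add: axis_def mult_delta_left)

lemma norm_squared_vec: "(\<Sum>k\<in>UNIV. y$k * y$k) = (norm (y :: real^'n))\<^sup>2"
  by (simp add: power2_norm_eq_inner inner_vec_def)

lemma sum_randers_dy:
  "(\<Sum>i\<in>UNIV. randers_dy b i x y * z$i) =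
    (2 * (y \<bullet> z) / norm y + b * (x \<bullet> z) / norm x) / (1 - (norm x)\<^sup>2)"
  by (simp add: randers_dy_def inner_vec_def sum_2 add_divide_distrib algebra_simps)

lemma randers_dy_euler:
  "(\<Sum>i\<in>UNIV. randers_dy b i x y * y$i) = randers_poincare b x y"
  by (simp add: sum_randers_dy randers_poincare_eq power2_norm_eq_inner[symmetric] power2_eq_square)

text \<open>The Hessian of the Euclidean norm is a multiple of the square of the covector \<open>(-y\<^sub>2, y\<^sub>1)\<close>, so
  the determinant is a multiple of the square of the Euler pairing of \<open>\<partial>F/\<partial>y\<close> with \<open>y\<close>.\<close>

lemma det_fundamental_tensor_randers:
  assumes "y \<noteq> 0"
  shows "det (fundamental_tensor (randers_poincare b) x y) =
    2 * randers_poincare b x y ^ 3 / ((1 - (norm x)\<^sup>2) * norm y ^ 3)"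
proof -
  let ?q = "norm y" and ?F = "randers_poincare b x y"
  let ?f = "\<lambda>i. randers_dy b i x y"
  have q: "?q > 0" using assms by simp
  have n: "y$1 * y$1 + y$2 * y$2 = ?q\<^sup>2"
    using norm_squared_vec[of y] by (simp add: sum_2)
  have F: "?F = ?f 1 * y$1 + ?f 2 * y$2"
    using randers_dy_euler[of b x y] by (simp add: sum_2)
  have E: "1 / ?q - y$1 * y$1 / ?q ^ 3 = y$2 * y$2 / ?q ^ 3"
    "1 / ?q - y$2 * y$2 / ?q ^ 3 = y$1 * y$1 / ?q ^ 3"
    using q n by (simp_all add: field_simps power3_eq_cube power2_eq_square)
  \<comment> \<open>Here \<open>f\<close>, \<open>g\<close> stand for the y-partials of
    \<open>F\<close>, \<open>u\<close>, \<open>v\<close> for the coordinates of \<open>y\<close>,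
    \<open>c\<close> for \<open>|y|^3\<close> and \<open>m\<close> for \<open>1 - |x|^2\<close>; by
    Euler's identity \<open>f * u + g * v\<close> is \<open>F\<close>. On the unit circle
    \<open>m = 0\<close>, and both sides are 0 by the convention on division.\<close>
  have *: "(f * f + F * (2 * (v * v / c) / m)) * (g * g + F * (2 * (u * u / c) / m))
      - (f * g + F * (2 * (0 - u * v / c) / m)) * (g * f + F * (2 * (0 - v * u / c) / m)) =
      2 * F * (f * u + g * v)\<^sup>2 / (m * c)" if "c \<noteq> 0" for f g F u v c m :: real
    using that by (cases "m = 0") (simp_all add: field_simps power2_eq_square)
  show ?thesis
    unfolding det_2 fundamental_tensor_randers[OF assms] axis_2_nth E div_0
    using q by (subst *) (simp_all flip: F add: power2_eq_square power3_eq_cube)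
qed

section \<open>Closed form of the spray\<close>

text \<open>For a conformally flat metric exp(2 phi) |y|^2 the spray is dphi(y) y - (|y|^2 / 2) grad
  phi; here exp(phi) = 2 / (1 - |x|^2).\<close>

definition poincare_spray :: "2 \<Rightarrow> 2 tangent_fun" where
  "poincare_spray i x y = (2 * (x \<bullet> y) * y$i - (norm y)\<^sup>2 * x$i) / (1 - (norm x)\<^sup>2)"

text \<open>For closed \<open>\<beta>\<close> the projective factor of \<open>\<alpha> + \<beta>\<close> is the Hessian
  \<open>\<beta>\<^bsub>i|j\<^esub> y\<^sup>i y\<^sup>j\<close> with respect to \<open>\<alpha>\<close>, divided by \<open>2 F\<close>.\<close>

definition randers_projective_factor :: "real \<Rightarrow> 2 tangent_fun" where
  "randers_projective_factor b x y =
    b * (1 + (norm x)\<^sup>2) * ((norm x)\<^sup>2 * (norm y)\<^sup>2 - (x \<bullet> y)\<^sup>2) /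
      (2 * norm x ^ 3 * (1 - (norm x)\<^sup>2)\<^sup>2 * randers_poincare b x y)"

text \<open>Needed for \<open>z = y\<close> and \<open>z = x\<close>, since the spray lies in the
  span of these two vectors.\<close>

lemma fundamental_tensor_randers_mult:
  assumes "y \<noteq> 0"
  shows "(\<Sum>j\<in>UNIV. fundamental_tensor (randers_poincare b) x y $ i $ j * z$j) =
    randers_dy b i x y * (\<Sum>j\<in>UNIV. randers_dy b j x y * z$j) +
    randers_poincare b x y * (2 * (z$i / norm y - (y \<bullet> z) * y$i / norm y ^ 3) / (1 - (norm x)\<^sup>2))"
proof -
  have "(\<Sum>j\<in>UNIV. (2 * (axis i 1 $ j / norm y - y$i * y$j / norm y ^ 3) / (1 - (norm x)\<^sup>2)) * z$j)
     = 2 * ((\<Sum>j\<in>UNIV. axis j 1 $ i * z$j) / norm y - (\<Sum>j\<in>UNIV. y$j * z$j) * y$i / norm y ^ 3) / (1 - (norm x)\<^sup>2)"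
    by (simp add: sum_distrib_left sum_distrib_right sum_divide_distrib sum_subtractf[symmetric] axis_def)
       (intro sum.cong, auto simp: field_simps)
  moreover have "(\<Sum>j\<in>UNIV. fundamental_tensor (randers_poincare b) x y $ i $ j * z$j) =
      randers_dy b i x y * (\<Sum>j\<in>UNIV. randers_dy b j x y * z$j) + randers_poincare b x y *
      (\<Sum>j\<in>UNIV. (2 * (axis i 1 $ j / norm y - y$i * y$j / norm y ^ 3) / (1 - (norm x)\<^sup>2)) * z$j)"
    unfolding fundamental_tensor_randers[OF assms] sum_2 by algebra
  ultimately show ?thesis
    by (simp only: sum_vec_mult_axis inner_vec_def inner_real_def)
qed

text \<open>Because \<beta> is closed, the terms
  \<open>b * (y$l / |x| - (x \<bullet> y) * x$l / |x|^3)\<close> from the mixed derivative and from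
  \<open>pdx l\<close> cancel. What remains is a combination of \<open>randers_dy b l x y\<close>
  and \<open>x$l\<close>.\<close>

lemma spray_rhs_randers:
  assumes "x \<in> unit_disc - {0}" "y \<noteq> 0"
  shows "(\<Sum>k\<in>UNIV. pdx k (pdy l (fsq (randers_poincare b))) x y * y$k) - pdx l (fsq (randers_poincare b)) x y
    = 2 * randers_dy b l x y * ((b * ((norm y)\<^sup>2 / norm x - (x \<bullet> y)\<^sup>2 / norm x ^ 3)
          + 2 * (x \<bullet> y) * randers_poincare b x y) / (1 - (norm x)\<^sup>2))
      + 4 * randers_poincare b x y * ((x \<bullet> y) * randers_dy b l x y
          - x$l * randers_poincare b x y) / (1 - (norm x)\<^sup>2)"
proof -
  let ?F = "randers_poincare b x y" and ?f = "randers_dy b l x y" and ?m = "1 - (norm x)\<^sup>2"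
  have dx: "(\<Sum>k\<in>UNIV. randers_dx b k x y * y$k) =
      (b * ((norm y)\<^sup>2 / norm x - (x \<bullet> y)\<^sup>2 / norm x ^ 3) + 2 * (x \<bullet> y) * ?F) / ?m"
    unfolding randers_dx_def norm_squared_vec[symmetric] power2_eq_square[of "x \<bullet> y"]
    unfolding inner_vec_def
    by (simp add: sum_2 add_divide_distrib diff_divide_distrib algebra_simps)
  have dxdy: "(\<Sum>k\<in>UNIV. (b * (axis k 1 $ l / norm x - x$k * x$l / norm x ^ 3) + 2 * x$k * ?f) / ?m * y$k) =
      (b * (y$l / norm x - (x \<bullet> y) * x$l / norm x ^ 3) + 2 * (x \<bullet> y) * ?f) / ?m"
    unfolding sum_vec_mult_axis[of l y, symmetric] inner_vec_def
    by (simp add: sum_2 add_divide_distrib diff_divide_distrib algebra_simps)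
  have "(\<Sum>k\<in>UNIV. pdx k (pdy l (fsq (randers_poincare b))) x y * y$k) =
    2 * ((\<Sum>k\<in>UNIV. randers_dx b k x y * y$k) * ?f + ?F *
      (\<Sum>k\<in>UNIV. (b * (axis k 1 $ l / norm x - x$k * x$l / norm x ^ 3) + 2 * x$k * ?f) / ?m * y$k))"
    unfolding pdx_pdy_fsq_randers[OF assms]
    unfolding sum_2 by algebra
  then show ?thesis
    unfolding dx dxdy pdx_fsq_randers[OF assms(1)]
    unfolding randers_dx_def by (simp add: add_divide_distrib diff_divide_distrib algebra_simps)
qed

text \<open>The spray solves a linear system with the fundamental tensor as matrix, so a candidate
  can be checked by substitution, without computing the inverse.\<close>

lemma spray_coeff_eqI:
  assumes "det (fundamental_tensor F x y) \<noteq> 0"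
    and "\<And>l. (\<Sum>j\<in>UNIV. fundamental_tensor F x y $ l $ j * (4 * G$j)) =
      (\<Sum>k\<in>UNIV. pdx k (pdy l (fsq F)) x y * y$k) - pdx l (fsq F) x y"
  shows "spray_coeff F i x y = G$i"
proof -
  let ?A = "fundamental_tensor F x y"
  have "matrix_inv ?A ** ?A = mat 1"
    using assms(1) someI_ex[of "\<lambda>A'. ?A ** A' = mat 1 \<and> A' ** ?A = mat 1"]
    unfolding invertible_det_nz[symmetric] invertible_def matrix_inv_def by blast
  then have "matrix_inv ?A *v (?A *v (4 *\<^sub>R G)) = 4 *\<^sub>R G"
    by (simp add: matrix_vector_mul_assoc)
  then have "(\<Sum>l\<in>UNIV. matrix_inv ?A $ i $ l * (\<Sum>j\<in>UNIV. ?A $ l $ j * (4 * G$j))) = 4 * G$i"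
    by (simp add: matrix_vector_mult_def vec_eq_iff)
  then show ?thesis
    by (simp add: spray_coeff_def assms(2))
qed

text \<open>The candidate is a combination of \<open>y\<close> and \<open>x\<close>. Applying the
  fundamental tensor turns \<open>y\<close> into F dF, and \<open>x\<close> into a multiple of dF
  plus a Hessian term; these are matched with the right-hand side of the spray equation.\<close>

lemma spray_coeff_randers:
  assumes x: "x \<in> unit_disc - {0}" and y: "y \<noteq> 0" and b: "\<bar>b\<bar> < 2"
  shows "spray_coeff (randers_poincare b) i x y =
    poincare_spray i x y + randers_projective_factor b x y * y$i"
proof -
  let ?F = "randers_poincare b x y" and ?m = "1 - (norm x)\<^sup>2" and ?q = "norm y" and ?r = "norm x"
  let ?s = "x \<bullet> y"
  define P where "P = randers_projective_factor b x y"
  define c where "c = 2 * ?s / ?m + P"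
  define d where "d = - ?q\<^sup>2 / ?m"
  have F: "?F > 0" and m: "?m > 0" and q: "?q > 0" and r: "?r > 0"
    using randers_poincare_pos[OF x y b] square_norm_lt_1[OF x] x y by auto
  have PF: "P * ?F = b * (1 + ?r\<^sup>2) * (?r\<^sup>2 * ?q\<^sup>2 - ?s\<^sup>2) / (2 * ?r ^ 3 * ?m\<^sup>2)"
    using F by (simp add: P_def randers_projective_factor_def)
  have dy_x: "(\<Sum>j\<in>UNIV. randers_dy b j x y * x$j) = (2 * ?s / ?q + b * ?r) / ?m"
    using r by (simp add: sum_randers_dy inner_commute power2_norm_eq_inner[symmetric] power2_eq_square)
  \<comment> \<open>Comparison of the coefficients of dF, with the Hessian term set aside for
    \<open>pair\<close>.\<close>
  have coeff: "4 * (c * ?F + d * ((2 * ?s / ?q + b * ?r) / ?m)) =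
      2 * ((b * (?q\<^sup>2 / ?r - ?s\<^sup>2 / ?r ^ 3) + 2 * ?s * ?F) / ?m)"
  proof -
    have "c * ?F = 2 * ?s / ?m * ?F + b * (1 + ?r\<^sup>2) * (?r\<^sup>2 * ?q\<^sup>2 - ?s\<^sup>2) / (2 * ?r ^ 3 * ?m\<^sup>2)"
      by (simp add: c_def distrib_right PF)
    moreover have "4 * (2 * s / m * ((2 * q + b * s / r) / m) + b * (1 + r\<^sup>2) * (r\<^sup>2 * q\<^sup>2 - s\<^sup>2) / (2 * r ^ 3 * m\<^sup>2)
      + (- q\<^sup>2 / m) * ((2 * s / q + b * r) / m)) =
      2 * ((b * (q\<^sup>2 / r - s\<^sup>2 / r ^ 3) + 2 * s * ((2 * q + b * s / r) / m)) / m)"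
      if "m > 0" "q > 0" "r > 0" "m = 1 - r\<^sup>2" for m q r s :: real
    proof -
      \<comment> \<open>\<open>A\<close> is \<open>(1 - |x|^2) * F\<close>, and \<open>K\<close> is
        the Euclidean Hessian of \<open>|x|\<close> in direction \<open>y\<close>, to which the
        projective factor is proportional.\<close>
      define A K where "A = 2 * q + b * s / r" and "K = q\<^sup>2 / r - s\<^sup>2 / r ^ 3"
      have K1: "r\<^sup>2 * q\<^sup>2 - s\<^sup>2 = r ^ 3 * K" and K2: "r\<^sup>2 * K = r * q\<^sup>2 - s\<^sup>2 / r"
        using \<open>r > 0\<close> by (simp_all add: K_def field_simps power2_eq_square power3_eq_cube)
      have K3: "b * (1 + r\<^sup>2) * (r ^ 3 * K) / (2 * r ^ 3 * m\<^sup>2) = b * (1 + r\<^sup>2) * K / 2 / m\<^sup>2"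
        using \<open>r > 0\<close> by simp
      have K4: "q\<^sup>2 * (2 * s / q + b * r) = 2 * s * q + b * (r * q\<^sup>2)"
        using \<open>q > 0\<close> by (simp add: algebra_simps power2_eq_square)
      have "4 * (2 * s / m * (A / m) + b * (1 + r\<^sup>2) * (r\<^sup>2 * q\<^sup>2 - s\<^sup>2) / (2 * r ^ 3 * m\<^sup>2)
          + (- q\<^sup>2 / m) * ((2 * s / q + b * r) / m)) =
        (8 * s * A + 2 * (b * (1 + r\<^sup>2) * K) - 4 * (q\<^sup>2 * (2 * s / q + b * r))) / m\<^sup>2"
        unfolding K1 K3 using \<open>m > 0\<close> by (simp add: field_simps power2_eq_square)
      also have "8 * s * A + 2 * (b * (1 + r\<^sup>2) * K) - 4 * (q\<^sup>2 * (2 * s / q + b * r)) =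
          8 * s * A + 2 * b * K + 2 * b * (r\<^sup>2 * K) - 4 * (2 * s * q + b * (r * q\<^sup>2))"
        unfolding K4 by (simp add: algebra_simps)
      \<comment> \<open>By \<open>K2\<close> the \<open>x\<close>-part contributes
        \<open>- 4 * b * r^2 * K - 4 * s * A\<close>; this turns the factor \<open>1 + r^2\<close>
        of the projective factor into \<open>1 - r^2 = m\<close>.\<close>
      also have "\<dots> = 2 * b * K - 2 * b * (r\<^sup>2 * K) + 4 * s * A"
        unfolding K2 A_def by (simp add: algebra_simps power2_eq_square)
      also have "\<dots> = 2 * m * b * K + 4 * s * A"
        unfolding that(4) by (simp add: algebra_simps)
      also have "\<dots> / m\<^sup>2 = 2 * ((b * K + 2 * s * (A / m)) / m)"
        using \<open>m > 0\<close> by (simp add: field_simps power2_eq_square)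
      finally show ?thesis
        unfolding A_def K_def .
    qed
    ultimately show ?thesis
      using m q r unfolding d_def randers_poincare_eq by simp
  qed
  have pair: "4 * (c * ?F * randers_dy b l x y +
      d * (randers_dy b l x y * ((2 * ?s / ?q + b * ?r) / ?m) +
        ?F * (2 * (x$l / ?q - ?s * y$l / ?q ^ 3) / ?m))) =
      2 * randers_dy b l x y * ((b * (?q\<^sup>2 / ?r - ?s\<^sup>2 / ?r ^ 3) + 2 * ?s * ?F) / ?m)
      + 4 * ?F * (?s * randers_dy b l x y - x$l * ?F) / ?m" for l
  proof -
    \<comment> \<open>On the right the two \<beta>-contributions
      \<open>b * (x \<bullet> y) * x$l / |x|\<close> cancel, leaving the Hessian of the Euclidean
      norm.\<close>
    have "?q\<^sup>2 * (2 * (x$l / ?q - ?s * y$l / ?q ^ 3)) / ?m = x$l * ?F - ?s * randers_dy b l x y"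
      unfolding randers_poincare_eq randers_dy_def using q
      by (simp add: power2_eq_square power3_eq_cube add_divide_distrib diff_divide_distrib algebra_simps)
    moreover have "d * (?F * (2 * Z / ?m)) = - (?F * (?q\<^sup>2 * (2 * Z) / ?m)) / ?m" for Z
      by (simp add: d_def)
    ultimately have "d * (?F * (2 * (x$l / ?q - ?s * y$l / ?q ^ 3) / ?m)) =
        - (?F * (x$l * ?F - ?s * randers_dy b l x y)) / ?m"
      by (simp only:)
    also have "\<dots> = ?F * (?s * randers_dy b l x y - x$l * ?F) / ?m"
      by (simp add: right_diff_distrib)
    finally have "d * (?F * (2 * (x$l / ?q - ?s * y$l / ?q ^ 3) / ?m)) =
        ?F * (?s * randers_dy b l x y - x$l * ?F) / ?m" .
    then show ?thesis using coeff by algebra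
  qed
  have G: "(\<Sum>j\<in>UNIV. fundamental_tensor (randers_poincare b) x y $ l $ j * (4 * (c *\<^sub>R y + d *\<^sub>R x) $ j)) =
      4 * (c * (\<Sum>j\<in>UNIV. fundamental_tensor (randers_poincare b) x y $ l $ j * y$j) +
        d * (\<Sum>j\<in>UNIV. fundamental_tensor (randers_poincare b) x y $ l $ j * x$j))" for l
    by (simp add: sum_2 algebra_simps)
  have "spray_coeff (randers_poincare b) i x y = (c *\<^sub>R y + d *\<^sub>R x) $ i"
  proof (rule spray_coeff_eqI)
    show "det (fundamental_tensor (randers_poincare b) x y) \<noteq> 0"
      using F m q by (simp add: det_fundamental_tensor_randers[OF y])
  next
    fix l
    have "(\<Sum>j\<in>UNIV. fundamental_tensor (randers_poincare b) x y $ l $ j * y$j) = ?F * randers_dy b l x y"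
      unfolding fundamental_tensor_randers_mult[OF y] randers_dy_euler power2_norm_eq_inner[symmetric]
      using q by (simp add: power2_eq_square power3_eq_cube)
    moreover have "(\<Sum>j\<in>UNIV. fundamental_tensor (randers_poincare b) x y $ l $ j * x$j) =
      randers_dy b l x y * ((2 * ?s / ?q + b * ?r) / ?m) +
        ?F * (2 * (x$l / ?q - ?s * y$l / ?q ^ 3) / ?m)"
      unfolding fundamental_tensor_randers_mult[OF y] dy_x by (simp add: inner_commute)
    ultimately show "(\<Sum>j\<in>UNIV. fundamental_tensor (randers_poincare b) x y $ l $ j * (4 * (c *\<^sub>R y + d *\<^sub>R x) $ j)) =
      (\<Sum>k\<in>UNIV. pdx k (pdy l (fsq (randers_poincare b))) x y * y$k) - pdx l (fsq (randers_poincare b)) x y"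
      unfolding G spray_rhs_randers[OF x y] using pair[of l] by (simp only: mult.assoc)
  qed
  also have "\<dots> = poincare_spray i x y + P * y$i"
    by (simp add: poincare_spray_def c_def d_def algebra_simps diff_divide_distrib)
  finally show ?thesis by (simp add: P_def)
qed

section \<open>Curvature of radial flags\<close>

lemma axis_in_punctured_disc:
  assumes "0 < a" "a < 1"
  shows "a *\<^sub>R axis 1 1 \<in> unit_disc - {0}"
  using assms unfolding punctured_disc_iff by (simp add: norm_axis_1 axis_eq_0_iff)

text \<open>Equality in Cauchy-Schwarz for parallel vectors.\<close>

lemma projective_factor_radial:
  "randers_projective_factor b (a *\<^sub>R axis 1 1) (u *\<^sub>R axis 1 1) = 0"
  by (simp add: randers_projective_factor_def norm_axis_1 inner_axis power_mult_distrib)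

lemma pdx_spray_radial:
  assumes a: "0 < a" "a < 1" and u: "u \<noteq> 0" and b: "\<bar>b\<bar> < 2"
  shows "pdx 2 (spray_coeff (randers_poincare b) 2) (a *\<^sub>R axis 1 1) (u *\<^sub>R axis 1 1) = - u\<^sup>2 / (1 - a\<^sup>2)"
proof (rule pdx_eqI[OF open_punctured_disc axis_in_punctured_disc[OF a]])
  \<comment> \<open>Since the second coordinate of the vector is 0, the projective term drops out at
    every base point, not only on the axis.\<close>
  show "spray_coeff (randers_poincare b) 2 x (u *\<^sub>R axis 1 1) =
      - u\<^sup>2 * x$2 / (1 - x \<bullet> x)" if "x \<in> unit_disc - {0}" for x
    using that u b
    by (subst spray_coeff_randers)
       (auto simp: poincare_spray_def norm_axis_1 power2_norm_eq_inner axis_2_nth axis_eq_0_iff)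
  have "a\<^sup>2 < 1"
    using a by (simp add: abs_square_less_1)
  then have "((\<lambda>t. - u\<^sup>2 * t / (1 - (a\<^sup>2 + t\<^sup>2))) has_real_derivative - u\<^sup>2 / (1 - a\<^sup>2)) (at 0)"
    by (intro DERIV_cong[OF DERIV_divide[OF DERIV_cmult[OF DERIV_ident]
          DERIV_diff[OF DERIV_const DERIV_add[OF DERIV_const DERIV_power[OF DERIV_ident]]]]])
       auto
  then show "((\<lambda>t. - u\<^sup>2 * (a *\<^sub>R axis 1 1 + t *\<^sub>R axis 2 1 :: real^2) $ 2 /
      (1 - (a *\<^sub>R axis 1 1 + t *\<^sub>R axis 2 1 :: real^2) \<bullet> (a *\<^sub>R axis 1 1 + t *\<^sub>R axis 2 1)))
      has_real_derivative - u\<^sup>2 / (1 - a\<^sup>2)) (at 0)"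
    by (simp add: inner_vec_def sum_2 axis_2_nth power2_eq_square)
qed

text \<open>Moving \<open>y\<close> transversally by \<open>t\<close> makes the Cauchy-Schwarz
  defect \<open>a^2 * t^2\<close>, so the projective term is of order \<open>t^3\<close> and only
  the spray of \<alpha> contributes.\<close>

lemma pdy_spray_radial:
  assumes a: "0 < a" "a < 1" and u: "u \<noteq> 0" and b: "\<bar>b\<bar> < 2"
  shows "pdy 2 (spray_coeff (randers_poincare b) 2) (a *\<^sub>R axis 1 1) (u *\<^sub>R axis 1 1) =
    2 * a * u / (1 - a\<^sup>2)"
proof (rule pdy_eqI[where S = "-{0}"])
  let ?x = "a *\<^sub>R axis 1 1 :: real^2" and ?y = "u *\<^sub>R axis 1 1 :: real^2"
  let ?F = "\<lambda>t. randers_poincare b ?x (?y + t *\<^sub>R axis 2 1)"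
  have x: "?x \<in> unit_disc - {0}" using axis_in_punctured_disc[OF a] .
  show "spray_coeff (randers_poincare b) 2 ?x y =
      2 * a / (1 - a\<^sup>2) * y$1 * y$2 + randers_projective_factor b ?x y * y$2" if "y \<in> -{0}" for y
    using that x b by (subst spray_coeff_randers)
      (auto simp: poincare_spray_def norm_axis_1 inner_axis' axis_2_nth axis_eq_0_iff)
  have a2: "a\<^sup>2 < 1"
    using a by (simp add: abs_square_less_1)
  have "((\<lambda>t. 2 * a / (1 - a\<^sup>2) * u * t) has_real_derivative 2 * a * u / (1 - a\<^sup>2)) (at 0)"
    by (rule DERIV_cong[OF DERIV_cmult[OF DERIV_ident]]) simp
  moreover have "((\<lambda>t. b * (1 + a\<^sup>2) * (a\<^sup>2 * t\<^sup>2) / (2 * a ^ 3 * (1 - a\<^sup>2)\<^sup>2 * ?F t) * t)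
      has_real_derivative 0) (at 0)"
  proof -
    have "?F 0 > 0"
      using randers_poincare_pos[OF x _ b, of ?y] u by (simp add: axis_eq_0_iff)
    moreover have "(?F has_real_derivative randers_dy b 2 ?x ?y) (at 0)"
      using u by (intro randers_has_dy) (simp add: axis_eq_0_iff)
    ultimately show ?thesis
      using a a2 by (intro DERIV_cong[OF DERIV_mult[OF DERIV_divide[OF DERIV_cmult[OF
        DERIV_cmult[OF DERIV_power[OF DERIV_ident]]] DERIV_cmult] DERIV_ident]]) auto
  qed
  moreover have "randers_projective_factor b ?x (?y + t *\<^sub>R axis 2 1) =
      b * (1 + a\<^sup>2) * (a\<^sup>2 * t\<^sup>2) / (2 * a ^ 3 * (1 - a\<^sup>2)\<^sup>2 * ?F t)" for t
  proof -
    have "(norm (?y + t *\<^sub>R axis 2 1))\<^sup>2 = u\<^sup>2 + t\<^sup>2" "?x \<bullet> (?y + t *\<^sub>R axis 2 1) = a * u"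
      unfolding power2_norm_eq_inner
      by (simp_all add: inner_vec_def sum_2 axis_2_nth power2_eq_square)
    moreover have "norm ?x = a"
      using a by (simp add: norm_axis_1)
    ultimately show ?thesis
      by (simp only: randers_projective_factor_def) (simp add: algebra_simps power_mult_distrib)
  qed
  ultimately have "((\<lambda>t. 2 * a / (1 - a\<^sup>2) * u * t + randers_projective_factor b ?x (?y + t *\<^sub>R axis 2 1) * t)
      has_real_derivative 2 * a * u / (1 - a\<^sup>2)) (at 0)"
    using DERIV_add by fastforce
  then show "((\<lambda>t. 2 * a / (1 - a\<^sup>2) * (?y + t *\<^sub>R axis 2 1)$1 * (?y + t *\<^sub>R axis 2 1)$2 +
      randers_projective_factor b ?x (?y + t *\<^sub>R axis 2 1) * (?y + t *\<^sub>R axis 2 1)$2)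
      has_real_derivative 2 * a * u / (1 - a\<^sup>2)) (at 0)"
    by (simp add: axis_2_nth axis_eq_0_iff)
qed (use u in \<open>simp_all add: axis_eq_0_iff open_Compl\<close>)

text \<open>The value is -\<alpha>^2, as for curvature -1. In the first two sums the
  \<open>j = 2\<close> terms vanish through the factors \<open>y$2\<close> and
  \<open>spray_coeff F 2\<close>, so the mixed second derivatives are needed only along the radial
  axis.\<close>

lemma riemann_curvature_radial:
  assumes a: "0 < a" "a < 1" and u: "u \<noteq> 0" and b: "\<bar>b\<bar> < 2"
  shows "riemann_curvature (randers_poincare b) 2 2 (a *\<^sub>R axis 1 1) (u *\<^sub>R axis 1 1) =
    - 4 * u\<^sup>2 / (1 - a\<^sup>2)\<^sup>2"
proof -
  let ?G = "spray_coeff (randers_poincare b)"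
  let ?x = "a *\<^sub>R axis 1 1 :: real^2" and ?y = "u *\<^sub>R axis 1 1 :: real^2"
  have a2: "a\<^sup>2 < 1"
    using a by (simp add: abs_square_less_1)
  have G: "?G i ?x (v *\<^sub>R axis 1 1) = (if i = 1 then a * v\<^sup>2 / (1 - a\<^sup>2) else 0)"
    if "v \<noteq> 0" for i v
    using that b axis_in_punctured_disc[OF a] exhaust_2[of i]
    by (subst spray_coeff_randers)
       (auto simp: axis_eq_0_iff poincare_spray_def projective_factor_radial norm_axis_1 axis_2_nth
         inner_axis power2_eq_square)
  \<comment> \<open>Shifting the base point along the first axis keeps the flag radial, so
    \<open>pdy_spray_radial\<close> can be differentiated in \<open>a\<close>, and below likewise in
    \<open>u\<close>.\<close>
  have "deriv (\<lambda>t. pdy 2 (?G 2) ((a + t *\<^sub>R 1) *\<^sub>R axis 1 1) ?y) 0 = 2 * u * (1 + a\<^sup>2) / (1 - a\<^sup>2)\<^sup>2"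
  proof (rule line_deriv_eqI[where S = "{0<..<1}"])
    have "((\<lambda>t. 2 * u * (a + t) / (1 - (a + t)\<^sup>2)) has_real_derivative
        2 * u * (1 + a\<^sup>2) / (1 - a\<^sup>2)\<^sup>2) (at 0)"
      using a2 by (auto intro!: derivative_eq_intros simp: power2_eq_square field_simps)
    then show "((\<lambda>t. 2 * u * (a + t *\<^sub>R 1) / (1 - (a + t *\<^sub>R 1)\<^sup>2)) has_real_derivative
        2 * u * (1 + a\<^sup>2) / (1 - a\<^sup>2)\<^sup>2) (at 0)" by simp
  qed (use a u b in \<open>simp_all add: pdy_spray_radial mult_ac\<close>)
  then have d1: "pdx 1 (pdy 2 (?G 2)) ?x ?y = 2 * u * (1 + a\<^sup>2) / (1 - a\<^sup>2)\<^sup>2"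
    by (simp add: pdx_def scaleR_add_left)
  have "deriv (\<lambda>t. pdy 2 (?G 2) ?x ((u + t *\<^sub>R 1) *\<^sub>R axis 1 1)) 0 = 2 * a / (1 - a\<^sup>2)"
  proof (rule line_deriv_eqI[where S = "-{0}"])
    show "((\<lambda>t. 2 * a * (u + t *\<^sub>R 1) / (1 - a\<^sup>2)) has_real_derivative 2 * a / (1 - a\<^sup>2)) (at 0)"
      by (rule DERIV_cong[OF DERIV_cdivide[OF DERIV_cmult[OF DERIV_add[OF DERIV_const]]]])
         (auto intro!: derivative_eq_intros)
  qed (use a u b in \<open>simp_all add: pdy_spray_radial open_Compl\<close>)
  then have d2: "pdy 1 (pdy 2 (?G 2)) ?x ?y = 2 * a / (1 - a\<^sup>2)"
    by (simp add: pdy_def scaleR_add_left)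
  \<comment> \<open>This vanishing factor removes the \<open>j = 1\<close> term of the last sum, so
    \<open>pdy 2 (?G 1)\<close> need not be computed.\<close>
  have "deriv (\<lambda>t. ?G 2 ?x ((u + t *\<^sub>R 1) *\<^sub>R axis 1 1)) 0 = 0"
    by (rule line_deriv_eqI[where S = "-{0}" and g = "\<lambda>_. 0"]) (use u in \<open>simp_all add: G open_Compl\<close>)
  then have d3: "pdy 1 (?G 2) ?x ?y = 0"
    by (simp add: pdy_def scaleR_add_left)
  \<comment> \<open>The four groups of terms of the curvature formula in order: the last two cancel,
    and \<open>m + 1 + a * a = 2\<close>.\<close>
  have *: "2 * (- (u * u) / m) - u * (2 * u * (1 + a * a) / (m * m)) + 2 * (a * (u * u) / m * (2 * a / m))
      - 2 * a * u / m * (2 * a * u / m) = - 4 * (u * u) / (m * m)"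
    if "m \<noteq> 0" "m = 1 - a * a" for m
    using that(1) by (simp add: field_simps) (simp add: that(2) algebra_simps)
  show ?thesis
    unfolding riemann_curvature_def sum_2
    using *[of "1 - a\<^sup>2"] a2 u
    by (simp add: G d1 d2 d3 pdx_spray_radial[OF a u b] pdy_spray_radial[OF a u b]
        power2_eq_square axis_2_nth)
qed

theorem proposition1p2:
  fixes b :: real
  assumes "0 < b" and "b < 1"
  shows "\<not> has_constant_negative_flag_curvature (unit_disc - {0}) (randers_poincare b)"
proof
  assume "has_constant_negative_flag_curvature (unit_disc - {0}) (randers_poincare b)"
  then obtain K where "K < 0" and
    K: "has_constant_flag_curvature (unit_disc - {0}) (randers_poincare b) K"
    unfolding has_constant_negative_flag_curvature_def by blast
  let ?x = "(1/2) *\<^sub>R axis 1 1 :: real^2"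
  \<comment> \<open>In the component \<open>i = k = 2\<close> the last term of the curvature
    condition carries \<open>?y $ 2 = 0\<close>, leaving R = K F^2. The factor
    \<open>(3/4)^2\<close> from \<open>1 - |x|^2 = 3/4\<close> cancels.\<close>
  have "- 4 * u\<^sup>2 = K * (2 * \<bar>u\<bar> + b * u)\<^sup>2" if "u \<noteq> 0" for u
  proof -
    let ?y = "u *\<^sub>R axis 1 1 :: real^2"
    have "?x \<in> unit_disc - {0}" and "?y \<noteq> 0"
      using axis_in_punctured_disc[of "1/2"] that by (simp_all add: axis_eq_0_iff)
    then have "riemann_curvature (randers_poincare b) 2 2 ?x ?y =
        K * ((randers_poincare b ?x ?y)\<^sup>2 * 1 -
          randers_poincare b ?x ?y * pdy 2 (randers_poincare b) ?x ?y * ?y $ 2)"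
      using K unfolding has_constant_flag_curvature_def by presburger
    also have "?y $ 2 = 0"
      by (simp add: axis_2_nth axis_eq_0_iff)
    also have "randers_poincare b ?x ?y = (2 * \<bar>u\<bar> + b * u) / (3/4)"
      by (simp add: randers_poincare_eq norm_axis_1 inner_axis power2_eq_square)
    also have "riemann_curvature (randers_poincare b) 2 2 ?x ?y = - 4 * u\<^sup>2 / (3/4)\<^sup>2"
      using riemann_curvature_radial[of "1/2" u b] that assms
      by (simp add: power_divide)
    finally show ?thesis
      by (simp add: power2_eq_square algebra_simps)
  qed
  \<comment> \<open>Outward and inward vectors have the same \<alpha> but opposite \<beta>.\<close>
  from this[of 1] this[of "-1"] have "K * (2 + b)\<^sup>2 = K * (2 - b)\<^sup>2"
    by simp
  with \<open>K < 0\<close> have "(2 + b)\<^sup>2 = (2 - b)\<^sup>2"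
    by simp
  with \<open>0 < b\<close> show False
    by (simp add: power2_eq_square algebra_simps)
qed

end
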